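(* Let $0<q<1$ and $n\ge 1$, and let $G=(G_1,\dots,G_n)$ be a sequence of i.i.d. random variables with $\mathbb{P}(G_i=k)=q^k(1-q)$ for $k=0,1,2,\dots$. Then for every $\pi\in\mathfrak{S}_n$, \[ \mathbb{P}(\Gamma_n(G)=\pi)=\frac{q^{\mathrm{maj}(\pi)}}{[n]_q!}, \] i.e. $\Gamma_n(G)$ follows the major index distribution $\mathrm{Maj}(n,q)$.
   Context: For $\pi\in\mathfrak{S}_n$, $\mathrm{Des}(\pi)=\{i\in[n-1]:\pi(i)>\pi(i+1)\}$ and the major index is $\mathrm{maj}(\pi)=\sum_{i\in\mathrm{Des}(\pi)} i$. The $q$-integers are $[m]_q=1+q+\dots+q^{m-1}$ and $[n]_q!=[1]_q[2]_q\cdots[n]_q$. For $q>0$, $\mathrm{Maj}(n,q)$ is the distribution on $\mathfrak{S}_n$ with $\mathbb{P}(\mathrm{Maj}(n,q)=\pi)=q^{\mathrm{maj}(\pi)}/[n]_q!$. The map $\Gamma_n:\mathbb{Z}_{\ge0}^n\to\mathfrak{S}_n$ is defined as follows: given $G=(G_1,\dots,G_n)$, totally order the pairs $(G_i,i)$ by declaring $(G_i,i)\preceq(G_j,j)$ if $G_i>G_j$, or $G_i=G_j$ and $i<j$; the induced order on the second coordinates, read in ascending order, is the one-line notation of $\Gamma_n(G)$ (so $\Gamma_n(G)(1)$ is the index of the $\preceq$-smallest pair, etc.). For example, $G=(5,2,3,3,0,1,6)$ gives $\Gamma_7(G)=7134265$. *)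

theory Defs
  imports "HOL-Probability.Probability" "HOL-Combinatorics.Permutations"
begin

text \<open>
  The symmetric group on \<open>[n]\<close> is the set of functions \<open>\<pi> :: nat \<Rightarrow> nat\<close> with
  \<open>\<pi> permutes {1..n}\<close>; such a \<open>\<pi>\<close> is the identity outside \<open>{1..n}\<close>.
\<close>

definition sym_grp :: "nat \<Rightarrow> (nat \<Rightarrow> nat) set" where
  "sym_grp n = {\<pi>. \<pi> permutes {1..n}}"

definition Des :: "nat \<Rightarrow> (nat \<Rightarrow> nat) \<Rightarrow> nat set" where
  "Des n \<pi> = {i \<in> {1..n - 1}. \<pi> i > \<pi> (i + 1)}"

definition maj :: "nat \<Rightarrow> (nat \<Rightarrow> nat) \<Rightarrow> nat" where
  "maj n \<pi> = (\<Sum>i\<in>Des n \<pi>. i)"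

definition q_int :: "real \<Rightarrow> nat \<Rightarrow> real" where
  "q_int q m = (\<Sum>i<m. q ^ i)"

definition q_fact :: "real \<Rightarrow> nat \<Rightarrow> real" where
  "q_fact q n = (\<Prod>m=1..n. q_int q m)"

text \<open>
  \<open>Maj(n,q)\<close>, as a measure on the symmetric group with all subsets measurable, given by
  its point masses. That the total mass is 1 is not part of the definition.
\<close>

definition Maj :: "nat \<Rightarrow> real \<Rightarrow> (nat \<Rightarrow> nat) measure" where
  "Maj n q = point_measure (sym_grp n) (\<lambda>\<pi>. ennreal (q ^ maj n \<pi> / q_fact q n))"

text \<open>The strict part of the total order \<open>\<preceq>\<close> on pairs \<open>(G\<^sub>i, i)\<close>.\<close>

fun prec :: "nat \<times> nat \<Rightarrow> nat \<times> nat \<Rightarrow> bool" where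
  "prec (g, i) (h, j) \<longleftrightarrow> g > h \<or> (g = h \<and> i < j)"

text \<open>
  A sequence \<open>(G\<^sub>1, \<dots>, G\<^sub>n)\<close> is a function on \<open>nat\<close> of which only the values on \<open>{1..n}\<close>
  are used. \<open>Gamma_perm n G\<close> is the permutation listing the indices so that the pairs are
  \<open>\<preceq>\<close>-ascending; it is well defined by \<open>Gamma_perm_unique_exists\<close> below.
\<close>

definition Gamma_perm :: "nat \<Rightarrow> (nat \<Rightarrow> nat) \<Rightarrow> nat \<Rightarrow> nat" where
  "Gamma_perm n G = (THE \<pi>. \<pi> \<in> sym_grp n \<and>
     (\<forall>i\<in>{1..n}. \<forall>j\<in>{1..n}. i < j \<longrightarrow> prec (G (\<pi> i), \<pi> i) (G (\<pi> j), \<pi> j)))"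

lemma prec_key:
  assumes "i \<le> n" "j \<le> n"
  shows "prec (G i, i) (G j, j) \<longleftrightarrow>
    int i - int (G i) * (int n + 1) < int j - int (G j) * (int n + 1)" (is "_ \<longleftrightarrow> ?f i < ?f j")
proof -
  have gt: "?f a < ?f b" if "G a > G b" "a \<le> n" for a b
  proof -
    have "(int (G b) + 1) * (int n + 1) \<le> int (G a) * (int n + 1)"
      using that by (intro mult_right_mono) auto
    then show ?thesis using that(2) by (simp add: algebra_simps)
  qed
  consider "G i > G j" | "G i = G j" | "G i < G j" by linarith
  then show ?thesis
  proof cases
    case 3
    then show ?thesis using gt[of i j] assms by simp
  qed (use gt[of i j] gt[of j i] assms in auto)
qed

lemma Gamma_perm_unique_exists:
  "\<exists>!\<pi>. \<pi> \<in> sym_grp n \<and>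
     (\<forall>i\<in>{1..n}. \<forall>j\<in>{1..n}. i < j \<longrightarrow> prec (G (\<pi> i), \<pi> i) (G (\<pi> j), \<pi> j))"
  (is "\<exists>!\<pi>. ?P \<pi>")
proof -
  define f where "f i = int i - int (G i) * (int n + 1)" for i
  have f: "prec (G i, i) (G j, j) \<longleftrightarrow> f i < f j" if "i \<in> {1..n}" "j \<in> {1..n}" for i j
    using prec_key[of i n j G] that by (simp add: f_def)
  have inj: "inj_on f {1..n}"
  proof (rule inj_onI)
    fix i j assume ij: "i \<in> {1..n}" "j \<in> {1..n}" "f i = f j"
    then have "\<not> prec (G i, i) (G j, j)" "\<not> prec (G j, j) (G i, i)" using f by auto
    then show "i = j" by auto
  qed
  define xs where "xs = sort_key f [1..<Suc n]"
  have xs: "length xs = n" "distinct xs" "set xs = {1..n}" "sorted (map f xs)"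
    by (auto simp: xs_def)
  define p where "p i = (if i \<in> {1..n} then xs ! (i - 1) else i)" for i
  have "inj_on p {1..n}"
    by (auto simp: inj_on_def p_def nth_eq_iff_index_eq xs)
  moreover have "p ` {1..n} \<subseteq> {1..n}"
  proof
    fix y assume "y \<in> p ` {1..n}"
    then obtain i where "i \<in> {1..n}" "y = xs ! (i - 1)" by (auto simp: p_def)
    then have "y \<in> set xs" using xs(1) by (auto intro!: nth_mem)
    then show "y \<in> {1..n}" using xs(3) by simp
  qed
  ultimately have "bij_betw p {1..n} {1..n}"
    by (simp add: bij_betw_def endo_inj_surj)
  then have p: "p permutes {1..n}"
    by (rule bij_imp_permutes) (auto simp: p_def)
  have "prec (G (p i), p i) (G (p j), p j)" if ij: "i \<in> {1..n}" "j \<in> {1..n}" "i < j" for i j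
  proof -
    have m: "p i \<in> {1..n}" "p j \<in> {1..n}" using ij by (simp_all only: permutes_in_image[OF p])
    have "f (p i) \<le> f (p j)"
      using sorted_nth_mono[OF xs(4), of "i - 1" "j - 1"] ij xs(1) by (auto simp: p_def)
    moreover have "p i \<noteq> p j" using permutes_inj[OF p] ij by (auto dest: injD)
    then have "f (p i) \<noteq> f (p j)" using inj m by (auto dest: inj_onD)
    ultimately show ?thesis using f m by simp
  qed
  then have ex: "?P p" using p by (auto simp: sym_grp_def)
  have "a = b" if "?P a" "?P b" for a b
  proof -
    have *: "sorted (map f (map r [1..<Suc n])) \<and> distinct (map f (map r [1..<Suc n])) \<and>
        set (map f (map r [1..<Suc n])) = f ` {1..n}" if r: "?P r" for r
    proof -
      have rp: "r permutes {1..n}" using r by (simp add: sym_grp_def)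
      have im: "r ` {1..n} = {1..n}" by (rule permutes_image[OF rp])
      have in_r: "r i \<in> {1..n}" if "i \<in> {1..n}" for i using im that by blast
      have mono: "f (r i) < f (r j)" if "i \<in> {1..n}" "j \<in> {1..n}" "i < j" for i j
        using r that f[of "r i" "r j"] in_r by blast
      have "sorted_wrt (<) (map f (map r [1..<Suc n]))"
        by (auto simp: sorted_wrt_iff_nth_less simp del: upt_Suc intro!: mono)
      moreover have "set (map f (map r [1..<Suc n])) = f ` (r ` {1..n})"
        by (auto simp: atLeastLessThanSuc_atLeastAtMost simp del: upt_Suc)
      ultimately show ?thesis using im by (simp only: strict_sorted_iff simp_thms)
    qed
    have "map f (map a [1..<Suc n]) = map f (map b [1..<Suc n])"
      using *[OF that(1)] *[OF that(2)] by (intro sorted_distinct_set_unique) auto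
    then have fe: "f (a i) = f (b i)" if "i \<in> {1..n}" for i
      using that by (auto simp: atLeastLessThanSuc_atLeastAtMost simp del: upt_Suc)
    have perm: "a permutes {1..n}" "b permutes {1..n}"
      using that by (auto simp: sym_grp_def)
    show "a = b"
    proof
      fix i show "a i = b i"
      proof (cases "i \<in> {1..n}")
        case True
        then have "a i \<in> {1..n}" "b i \<in> {1..n}"
          by (simp_all only: permutes_in_image[OF perm(1)] permutes_in_image[OF perm(2)])
        then show ?thesis using inj fe[OF True] by (auto dest: inj_onD)
      next
        case False
        then show ?thesis using perm by (simp add: permutes_not_in)
      qed
    qed
  qed
  with ex show ?thesis by blast
qed

lemma Gamma_perm_sym_grp: "Gamma_perm n G \<in> sym_grp n"
  using theI'[OF Gamma_perm_unique_exists[of n G]] unfolding Gamma_perm_def by blast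

lemma Gamma_perm_prec:
  assumes "i \<in> {1..n}" "j \<in> {1..n}" "i < j"
  shows "prec (G (Gamma_perm n G i), Gamma_perm n G i) (G (Gamma_perm n G j), Gamma_perm n G j)"
  using theI'[OF Gamma_perm_unique_exists[of n G]] assms unfolding Gamma_perm_def by blast

lemma Gamma_perm_eqI:
  assumes "\<pi> \<in> sym_grp n"
    and "\<And>i j. i \<in> {1..n} \<Longrightarrow> j \<in> {1..n} \<Longrightarrow> i < j \<Longrightarrow> prec (G (\<pi> i), \<pi> i) (G (\<pi> j), \<pi> j)"
  shows "Gamma_perm n G = \<pi>"
  unfolding Gamma_perm_def
  by (rule the1_equality[OF Gamma_perm_unique_exists]) (use assms in blast)

lemma Gamma_perm_example:
  fixes G :: "nat \<Rightarrow> nat"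
  assumes "map G [1..<8] = [5, 2, 3, 3, 0, 1, 6]"
  shows "map (Gamma_perm 7 G) [1..<8] = [7, 1, 3, 4, 2, 6, 5]"
proof -
  have U: "[1..<8] = [1, 2, 3, 4, 5, 6, 7::nat]" by (simp add: eval_nat_numeral)
  have G: "G 1 = 5" "G (Suc 0) = 5" "G 2 = 2" "G 3 = 3" "G 4 = 3" "G 5 = 0" "G 6 = 1" "G 7 = 6"
    using assms by (simp_all add: U[simplified])
  define p :: "nat \<Rightarrow> nat" where
    "p i = (if i \<in> {1..7} then [7, 1, 3, 4, 2, 6, 5] ! (i - 1) else i)" for i
  have S: "{1..7::nat} = {1, 2, 3, 4, 5, 6, 7}" by auto
  have pv: "p 1 = 7" "p 2 = 1" "p 3 = 3" "p 4 = 4" "p 5 = 2" "p 6 = 6" "p 7 = 5"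
    by (simp_all add: p_def)
  have "bij_betw p {1..7} {1..7}"
    unfolding bij_betw_def S inj_on_def using pv by auto
  then have "p permutes {1..7}" by (rule bij_imp_permutes) (auto simp: p_def)
  moreover have "prec (G (p i), p i) (G (p j), p j)"
    if "i \<in> {1..7}" "j \<in> {1..7}" "i < j" for i j
    using that unfolding S by (auto simp: pv pv(1)[simplified] G)
  ultimately have "Gamma_perm 7 G = p"
    by (intro Gamma_perm_eqI) (auto simp: sym_grp_def)
  then show ?thesis using pv unfolding U by simp
qed

end

theory Submission
  imports Defs
begin

text \<open>
  Put \<open>X i = G (\<pi> i)\<close>. Then \<open>\<Gamma>\<^sub>n(G) = \<pi>\<close> iff \<open>X i \<ge> X (i + 1) + d i\<close> for all \<open>1 \<le> i < n\<close>, where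
  \<open>d i\<close> is 1 at the descents of \<open>\<pi>\<close> and 0 elsewhere. The probability of the first \<open>m - 1\<close> of
  these constraints together with \<open>X m \<ge> k\<close> equals \<open>q ^ (m * k)\<close> times a constant: conditioning
  on the value of \<open>X (m + 1)\<close> turns the step from \<open>m\<close> to \<open>m + 1\<close> into a geometric series of
  ratio \<open>q ^ (m + 1)\<close>, which contributes the factor \<open>q ^ (m * d m) / [m + 1]\<^sub>q\<close>.
\<close>

lemma prec_trans: "prec x y \<Longrightarrow> prec y z \<Longrightarrow> prec x z"
  by (cases x; cases y; cases z) auto

text \<open>Since \<open>prec\<close> is transitive, it suffices to compare neighbouring positions.
  There a tie of values is resolved by the smaller index, so equality is allowed at an ascent of
  \<open>\<pi>\<close> and a strict inequality is forced at a descent; the \<open>of_bool\<close>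
  summand encodes this.\<close>

lemma Gamma_perm_eq_iff:
  assumes \<pi>: "\<pi> \<in> sym_grp n"
  shows "Gamma_perm n G = \<pi> \<longleftrightarrow>
    (\<forall>i\<in>{1..<n}. G (\<pi> (Suc i)) + of_bool (i \<in> Des n \<pi>) \<le> G (\<pi> i))"
proof -
  have Des: "i \<in> Des n \<pi> \<longleftrightarrow> \<pi> (Suc i) < \<pi> i" if "i \<in> {1..<n}" for i
    using that by (auto simp: Des_def)
  have "inj \<pi>" using \<pi> by (auto simp: sym_grp_def dest: permutes_inj)
  then have ne: "\<pi> i \<noteq> \<pi> (Suc i)" for i by (simp add: inj_eq)
  have adj: "prec (G (\<pi> i), \<pi> i) (G (\<pi> (Suc i)), \<pi> (Suc i)) \<longleftrightarrow>
      G (\<pi> (Suc i)) + of_bool (i \<in> Des n \<pi>) \<le> G (\<pi> i)" if "i \<in> {1..<n}" for i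
    using Des[OF that] ne[of i] by (cases "\<pi> i < \<pi> (Suc i)") auto
  show ?thesis
  proof
    assume "Gamma_perm n G = \<pi>"
    then show "\<forall>i\<in>{1..<n}. G (\<pi> (Suc i)) + of_bool (i \<in> Des n \<pi>) \<le> G (\<pi> i)"
      using Gamma_perm_prec[of _ n _ G] by (auto simp flip: adj)
  next
    assume A: "\<forall>i\<in>{1..<n}. G (\<pi> (Suc i)) + of_bool (i \<in> Des n \<pi>) \<le> G (\<pi> i)"
    have "prec (G (\<pi> i), \<pi> i) (G (\<pi> j), \<pi> j)" if "1 \<le> i" "i < j" "j \<le> n" for i j
    proof -
      have "Suc i \<le> j" using that by simp
      then show ?thesis using \<open>j \<le> n\<close>
      proof (induction j rule: dec_induct)
        case base
        then show ?case using A adj[of i] that(1) by simp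
      next
        case (step m)
        then have "prec (G (\<pi> m), \<pi> m) (G (\<pi> (Suc m)), \<pi> (Suc m))"
          using A adj[of m] \<open>1 \<le> i\<close> by simp
        moreover have "prec (G (\<pi> i), \<pi> i) (G (\<pi> m), \<pi> m)"
          using step by linarith
        ultimately show ?case by (rule prec_trans[rotated])
      qed
    qed
    then show "Gamma_perm n G = \<pi>" using \<pi> by (intro Gamma_perm_eqI) auto
  qed
qed

lemma (in prob_space) indep_sets_reindex:
  assumes "inj_on f I" and indep: "indep_sets F (f ` I)"
  shows "indep_sets (\<lambda>i. F (f i)) I"
  unfolding indep_sets_def
proof (intro conjI ballI allI impI)
  fix i assume "i \<in> I"
  then show "F (f i) \<subseteq> events"
    using indep by (auto simp: indep_sets_def)
next
  fix J A assume J: "J \<subseteq> I" "J \<noteq> {}" "finite J" and A: "A \<in> (\<Pi> j\<in>J. F (f j))"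
  define B where "B = A \<circ> inv_into I f"
  have B: "B (f j) = A j" if "j \<in> J" for j
    using that J \<open>inj_on f I\<close> by (auto simp: B_def)
  have "prob (\<Inter>i\<in>f ` J. B i) = (\<Prod>i\<in>f ` J. prob (B i))"
    using J A B by (intro indep_setsD[OF indep]) auto
  moreover have "inj_on f J"
    using \<open>inj_on f I\<close> J(1) by (rule inj_on_subset)
  ultimately show "prob (\<Inter>j\<in>J. A j) = (\<Prod>j\<in>J. prob (A j))"
    using B by (simp add: prod.reindex)
qed

lemma (in prob_space) indep_vars_reindex:
  assumes "inj_on f I" "indep_vars M' X (f ` I)"
  shows "indep_vars (\<lambda>i. M' (f i)) (\<lambda>i. X (f i)) I"
  using assms indep_sets_reindex[of f I "\<lambda>i. {X i -` A \<inter> space M |A. A \<in> sets (M' i)}"]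
  by (simp add: indep_vars_def2)

text \<open>A finite product of countable discrete spaces is again discrete. In this form every set
  of value tuples is measurable, so no later event needs its own measurability argument.\<close>

lemma (in prob_space) indep_var_restrict_countable:
  fixes X :: "'i \<Rightarrow> 'a \<Rightarrow> 'b :: countable"
  assumes "indep_vars (\<lambda>_. count_space UNIV) X I"
    and "A \<inter> B = {}" "A \<subseteq> I" "B \<subseteq> I" "finite A" "finite B"
  shows "indep_var (count_space (A \<rightarrow>\<^sub>E UNIV)) (\<lambda>\<omega>. restrict (\<lambda>i. X i \<omega>) A)
    (count_space (B \<rightarrow>\<^sub>E UNIV)) (\<lambda>\<omega>. restrict (\<lambda>i. X i \<omega>) B)"
  using indep_var_restrict[OF assms(1-4)] assms(5,6) by (simp add: count_space_PiM_finite)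

text \<open>The threshold \<open>k\<close> on the last variable is what makes the induction close:
  fixing the value of the next variable turns the link to it into such a threshold. Hence
  \<open>k\<close> must stay arbitrary.\<close>

lemma (in prob_space) prob_geometric_chain:
  fixes X :: "nat \<Rightarrow> 'a \<Rightarrow> nat" and d :: "nat \<Rightarrow> nat" and q :: real
  assumes q: "0 < q" "q < 1"
    and indep: "indep_vars (\<lambda>_. count_space UNIV) X {1..n}"
    and geo: "\<And>i k. i \<in> {1..n} \<Longrightarrow> \<P>(\<omega> in M. X i \<omega> = k) = q ^ k * (1 - q)"
    and "m \<le> n"
  shows "\<P>(\<omega> in M. \<forall>i\<in>{1..m}. (if i < m then X (Suc i) \<omega> + d i else k) \<le> X i \<omega>) =
    q ^ (m * k) * q ^ (\<Sum>i\<in>{1..<m}. i * d i) / q_fact q m"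
  using \<open>m \<le> n\<close>
proof (induction m arbitrary: k)
  case 0
  then show ?case by (simp add: q_fact_def prob_space)
next
  case (Suc m)
  define A where "A m k = {\<omega> \<in> space M. \<forall>i\<in>{1..m}.
    (if i < m then X (Suc i) \<omega> + d i else k) \<le> X i \<omega>}" for m k
  \<comment> \<open>With \<open>X (Suc m)\<close> fixed to \<open>j\<close>, the link between
    \<open>m\<close> and \<open>Suc m\<close> reads \<open>j + d m \<le> X m\<close>, a condition on
    the first \<open>m\<close> variables alone.\<close>
  define B where "B j = {\<omega> \<in> space M. X (Suc m) \<omega> = j} \<inter> A m (j + d m)" for j
  have Suc_m: "Suc m \<in> {1..n}"
    using Suc.prems by auto
  let ?R = "\<lambda>I \<omega>. restrict (\<lambda>i. X i \<omega>) I"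
  let ?P = "\<lambda>I. I \<rightarrow>\<^sub>E (UNIV :: nat set)"
  have ind: "indep_var (count_space (?P {1..m})) (?R {1..m}) (count_space (?P {Suc m})) (?R {Suc m})"
    using Suc.prems by (intro indep_var_restrict_countable[OF indep]) auto
  \<comment> \<open>The index \<open>Suc i\<close> is consulted only for \<open>i < m\<close>, so
    \<open>?E l\<close> looks only at coordinates in \<open>{1..m}\<close>.\<close>
  let ?E = "\<lambda>l. {x \<in> ?P {1..m}. \<forall>i\<in>{1..m}. (if i < m then x (Suc i) + d i else l) \<le> x i}"
  let ?F = "\<lambda>j. {x \<in> ?P {Suc m}. x (Suc m) = j}"
  have A_eq: "A m l = ?R {1..m} -` ?E l \<inter> space M" for l
    by (auto simp: A_def)
  have X_eq: "{\<omega> \<in> space M. X (Suc m) \<omega> = j} = ?R {Suc m} -` ?F j \<inter> space M" for j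
    by auto
  have B_sets: "B j \<in> events" for j
    unfolding B_def A_eq X_eq
    using indep_var_rv1[OF ind] indep_var_rv2[OF ind]
    by (intro sets.Int measurable_sets[of _ M]) auto
  have IH: "prob (A m l) = q ^ (m * l) * q ^ (\<Sum>i\<in>{1..<m}. i * d i) / q_fact q m" for l
    using Suc unfolding A_def by auto
  have prob_B: "prob (B j) = q ^ j * (1 - q) * prob (A m (j + d m))" for j
  proof -
    have "B j = (\<lambda>\<omega>. (?R {1..m} \<omega>, ?R {Suc m} \<omega>)) -` (?E (j + d m) \<times> ?F j) \<inter> space M"
      unfolding B_def A_eq X_eq by blast
    then have "prob (B j) = prob (A m (j + d m)) * \<P>(\<omega> in M. X (Suc m) \<omega> = j)"
      unfolding A_eq X_eq by (simp only:) (rule indep_varD[OF ind]; simp)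
    then show ?thesis by (simp add: geo[OF Suc_m])
  qed
  \<comment> \<open>Split by the value of \<open>X (Suc m)\<close>; being at least \<open>k\<close>,
    it is written as \<open>j + k\<close>.\<close>
  have "A (Suc m) k = (\<Union>j. B (j + k))"
  proof (intro set_eqI)
    fix \<omega>
    have "(if i < m then X (Suc i) \<omega> + d i else X (Suc m) \<omega> + d m) =
        (if i < Suc m then X (Suc i) \<omega> + d i else k)" if "i \<in> {1..m}" for i
      using that by (cases "i = m") auto
    then have "\<omega> \<in> A (Suc m) k \<longleftrightarrow> k \<le> X (Suc m) \<omega> \<and> \<omega> \<in> B (X (Suc m) \<omega>)"
      by (auto simp: A_def B_def atLeastAtMostSuc_conv)
    also have "\<dots> \<longleftrightarrow> (\<exists>j. X (Suc m) \<omega> = j + k \<and> \<omega> \<in> B (j + k))"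
      by (auto simp: le_iff_add add.commute)
    also have "\<dots> \<longleftrightarrow> \<omega> \<in> (\<Union>j. B (j + k))"
      by (auto simp: B_def)
    finally show "\<omega> \<in> A (Suc m) k \<longleftrightarrow> \<omega> \<in> (\<Union>j. B (j + k))" .
  qed
  moreover have "disjoint_family (\<lambda>j. B (j + k))"
    by (auto simp: disjoint_family_on_def B_def)
  ultimately have "(\<lambda>j. prob (B (j + k))) sums prob (A (Suc m) k)"
    using finite_measure_UNION[of "\<lambda>j. B (j + k)"] B_sets by auto
  moreover have "(\<lambda>j. prob (B (j + k))) sums
    (q ^ (Suc m * k) * q ^ (\<Sum>i\<in>{1..<Suc m}. i * d i) / q_fact q (Suc m))"
  proof -
    \<comment> \<open>The mass of \<open>X (Suc m)\<close> at \<open>j + k\<close> gives the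
      exponent \<open>j + k\<close>, the induction hypothesis gives
      \<open>m * (j + k + d m)\<close>. Together they make
      \<open>Suc m * j + Suc m * k + m * d m\<close>, so the ratio in \<open>j\<close> is
      \<open>q ^ Suc m\<close>.\<close>
    let ?C = "(1 - q) * q ^ (Suc m * k) * q ^ (\<Sum>i\<in>{1..<Suc m}. i * d i) / q_fact q m"
    have "q ^ Suc m < 1" using q by (intro power_Suc_less_one) auto
    then have "(\<lambda>j. ?C * (q ^ Suc m) ^ j) sums (?C * (1 / (1 - q ^ Suc m)))"
      using q by (intro sums_mult geometric_sums) auto
    moreover have "prob (B (j + k)) = ?C * (q ^ Suc m) ^ j" for j
    proof -
      have "(\<Sum>i\<in>{1..<Suc m}. i * d i) = (\<Sum>i\<in>{1..<m}. i * d i) + m * d m"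
        by (cases m) simp_all
      then show ?thesis
        by (simp add: prob_B IH power_add power_mult_distrib add_mult_distrib2 mult_ac flip: power_mult)
    qed
    moreover have "?C * (1 / (1 - q ^ Suc m)) =
        q ^ (Suc m * k) * q ^ (\<Sum>i\<in>{1..<Suc m}. i * d i) / q_fact q (Suc m)"
    proof -
      \<comment> \<open>Thus \<open>(1 - q) / (1 - q ^ Suc m)\<close> is the reciprocal of the new
        factor of \<open>q_fact q (Suc m)\<close>.\<close>
      have "(1 - q) * q_int q (Suc m) = 1 - q ^ Suc m"
        unfolding q_int_def by (rule one_diff_power_eq[symmetric])
      moreover have "1 - q \<noteq> 0" "1 - q ^ Suc m \<noteq> 0" using q \<open>q ^ Suc m < 1\<close> by auto
      ultimately show ?thesis
        by (auto simp: q_fact_def divide_simps)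
    qed
    ultimately show ?thesis by simp
  qed
  ultimately show ?case
    unfolding A_def by (rule sums_unique2)
qed

theorem theorem1p1:
  fixes M :: "'a measure" and G :: "nat \<Rightarrow> 'a \<Rightarrow> nat" and q :: real and n :: nat
  assumes "0 < q" and "q < 1" and "1 \<le> n"
    and "prob_space M"
    and "prob_space.indep_vars M (\<lambda>_. count_space UNIV) G {1..n}"
    and "\<And>i k. i \<in> {1..n} \<Longrightarrow> \<P>(\<omega> in M. G i \<omega> = k) = q ^ k * (1 - q)"
  shows "(\<forall>\<pi>\<in>sym_grp n.
            \<P>(\<omega> in M. Gamma_perm n (\<lambda>i. G i \<omega>) = \<pi>) = q ^ maj n \<pi> / q_fact q n) \<and>
         distr M (count_space (sym_grp n)) (\<lambda>\<omega>. Gamma_perm n (\<lambda>i. G i \<omega>)) = Maj n q"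
proof -
  interpret prob_space M by fact
  let ?\<Gamma> = "\<lambda>\<omega>. Gamma_perm n (\<lambda>i. G i \<omega>)"
  have fin: "finite (sym_grp n)"
    by (simp add: sym_grp_def finite_permutations)
  \<comment> \<open>\<open>Gamma_perm n\<close> sees only the values on \<open>{1..n}\<close>, so it
    factors through a tuple in a discrete space, on which every map is measurable.\<close>
  have meas: "?\<Gamma> \<in> measurable M (count_space (sym_grp n))"
  proof -
    have "Gamma_perm n x i \<in> {1..n}" if "i \<in> {1..n}" for x i
      using Gamma_perm_sym_grp[of n x] that by (simp only: sym_grp_def mem_Collect_eq permutes_in_image)
    then have "Gamma_perm n (restrict x {1..n}) = Gamma_perm n x" for x
      using Gamma_perm_prec[of _ n _ x]
      by (intro Gamma_perm_eqI[OF Gamma_perm_sym_grp]) (simp del: prec.simps atLeastAtMost_iff)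
    moreover have "(\<lambda>\<omega>. restrict (\<lambda>i. G i \<omega>) {1..n}) \<in> measurable M (count_space ({1..n} \<rightarrow>\<^sub>E UNIV))"
      \<comment> \<open>Pairing with the empty block extracts the measurability of the whole tuple
        from the independence statement.\<close>
      by (rule indep_var_rv1[OF indep_var_restrict_countable[OF assms(5), of _ "{}"]]) auto
    then have "(\<lambda>\<omega>. Gamma_perm n (restrict (\<lambda>i. G i \<omega>) {1..n})) \<in> measurable M (count_space (sym_grp n))"
      by (rule measurable_compose) (simp add: Gamma_perm_sym_grp)
    ultimately show ?thesis by simp
  qed
  have P: "prob {\<omega> \<in> space M. ?\<Gamma> \<omega> = \<pi>} = q ^ maj n \<pi> / q_fact q n" if \<pi>: "\<pi> \<in> sym_grp n" for \<pi>
  proof -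
    have p: "\<pi> permutes {1..n}" using \<pi> by (simp add: sym_grp_def)
    have "indep_vars (\<lambda>_. count_space UNIV) (\<lambda>i. G (\<pi> i)) {1..n}"
      using indep_vars_reindex[of \<pi> "{1..n}" "\<lambda>_. count_space UNIV" G] assms(5) p
      by (simp add: permutes_inj_on permutes_image)
    \<comment> \<open>With \<open>m = n\<close> and \<open>k = 0\<close> the final threshold always
      holds, leaving just the constraints that characterize \<open>\<pi>\<close>.\<close>
    then have "prob {\<omega> \<in> space M. \<forall>i\<in>{1..n}.
        (if i < n then G (\<pi> (Suc i)) \<omega> + of_bool (i \<in> Des n \<pi>) else 0) \<le> G (\<pi> i) \<omega>} =
      q ^ (n * 0) * q ^ (\<Sum>i\<in>{1..<n}. i * of_bool (i \<in> Des n \<pi>)) / q_fact q n"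
      by (rule prob_geometric_chain[OF assms(1,2) _ _ order.refl])
        (simp add: assms(6) permutes_in_image[OF p] del: atLeastAtMost_iff One_nat_def)
    moreover have "(\<Sum>i\<in>{1..<n}. i * of_bool (i \<in> Des n \<pi>)) = maj n \<pi>"
      unfolding maj_def by (rule sum.mono_neutral_cong_right) (auto simp: Des_def)
    moreover have "{\<omega> \<in> space M. \<forall>i\<in>{1..n}.
        (if i < n then G (\<pi> (Suc i)) \<omega> + of_bool (i \<in> Des n \<pi>) else 0) \<le> G (\<pi> i) \<omega>} =
      {\<omega> \<in> space M. ?\<Gamma> \<omega> = \<pi>}"
      unfolding Gamma_perm_eq_iff[OF \<pi>] by (intro Collect_cong) force
    ultimately show ?thesis by simp
  qed
  have "distr M (count_space (sym_grp n)) ?\<Gamma> = Maj n q"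
  proof (rule measure_eqI_finite[where A = "sym_grp n"])
    fix \<pi> assume \<pi>: "\<pi> \<in> sym_grp n"
    have "emeasure (distr M (count_space (sym_grp n)) ?\<Gamma>) {\<pi>} = emeasure M {\<omega> \<in> space M. ?\<Gamma> \<omega> = \<pi>}"
      using \<pi> by (subst emeasure_distr[OF meas]) (auto intro!: arg_cong[where f = "emeasure M"])
    also have "\<dots> = ennreal (q ^ maj n \<pi> / q_fact q n)"
      by (simp add: emeasure_eq_measure P[OF \<pi>])
    also have "\<dots> = emeasure (Maj n q) {\<pi>}"
      using \<pi> fin by (simp add: Maj_def emeasure_point_measure_finite)
    finally show "emeasure (distr M (count_space (sym_grp n)) ?\<Gamma>) {\<pi>} = emeasure (Maj n q) {\<pi>}" .
  qed (simp_all add: fin Maj_def sets_point_measure)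
  with P show ?thesis by blast
qed

end
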